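(* Let $\tau_0 \in \mathbb{C}$ with $\operatorname{Im} \tau_0 > 0$. Put $f_0(z) := 0$ and $f_n(z) := n^n\, \theta_{11}(n!\, z; \tau_0)$ for $n \geq 1$, and let $$F(z, w) := \sum_{n=0}^{\infty} f_n(z) w^n \in \mathcal{O}(\mathbb{C})[[w]].$$ If $z_0 \in \mathbb{C}$ and $z_0 \notin \mathbb{Q}\tau_0 + \mathbb{Q}$, then the power series $F|_{z = z_0}(w) = \sum_{n=0}^\infty f_n(z_0) w^n$ does not converge (i.e. its radius of convergence is $0$).
   Context: $\mathcal{O}(\mathbb{C})$ denotes the ring of entire functions. For $z \in \mathbb{C}$ and $\tau$ in the upper half plane $\mathbb{H} = \{\tau \in \mathbb{C} \mid \operatorname{Im}\tau > 0\}$, the elliptic theta function is $$\theta_{11}(z; \tau) := \sum_{m \in \mathbb{Z}} \exp\left( \pi \sqrt{-1} \left( \left(m + \tfrac12\right)^2 \tau + 2\left(m + \tfrac12\right)\left(z + \tfrac12\right) \right) \right),$$ which is holomorphic on $\mathbb{C} \times \mathbb{H}$. $\mathbb{Q}\tau_0 + \mathbb{Q} = \{ a\tau_0 + b \mid a, b \in \mathbb{Q} \}$. *)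

theory Defs
  imports "HOL-Complex_Analysis.Complex_Analysis"
begin

definition theta11 :: "complex \<Rightarrow> complex \<Rightarrow> complex" where
  "theta11 z \<tau> = (\<Sum>\<^sub>\<infinity>m\<in>(UNIV :: int set).
     exp (of_real pi * \<i> * ((of_int m + 1/2)\<^sup>2 * \<tau> + 2 * (of_int m + 1/2) * (z + 1/2))))"

definition rational_span :: "complex \<Rightarrow> complex set" where
  "rational_span \<tau> = {of_rat a * \<tau> + of_rat b | a b :: rat. True}"

definition f_coeff :: "complex \<Rightarrow> nat \<Rightarrow> complex \<Rightarrow> complex" where
  "f_coeff \<tau> n z = (if n = 0 then 0 else of_nat n ^ n * theta11 (fact n * z) \<tau>)"

text \<open>
  Elements of \<open>\<O>(\<complex>)[[w]]\<close> are formal power series whose coefficients are functions on the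
  complex plane that are holomorphic everywhere.
\<close>

definition entire_fps :: "(complex \<Rightarrow> complex) fps set" where
  "entire_fps = {F. \<forall>n. fps_nth F n holomorphic_on UNIV}"

definition F_series :: "complex \<Rightarrow> (complex \<Rightarrow> complex) fps" where
  "F_series \<tau> = Abs_fps (f_coeff \<tau>)"

definition restrict_at :: "(complex \<Rightarrow> complex) fps \<Rightarrow> complex \<Rightarrow> complex fps" where
  "restrict_at F z = Abs_fps (\<lambda>n. fps_nth F n z)"

lemma summable_on_exp_half_int:
  "(\<lambda>m::int. exp (- \<bar>of_int m + 1/2 :: real\<bar>)) summable_on UNIV"
proof -
  define g where "g = (\<lambda>m::int. exp (- \<bar>of_int m + 1/2 :: real\<bar>))"
  have geo: "(\<lambda>n::nat. exp (-1/2) * exp (-1::real) ^ n) summable_on UNIV"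
    by (intro summable_on_cmult_right norm_summable_imp_summable_on)
       (simp add: summable_geometric)
  have 1: "g summable_on range int"
  proof (subst summable_on_reindex)
    have "g \<circ> int = (\<lambda>n. exp (-1/2) * exp (-1::real) ^ n)"
      by (rule ext) (simp add: g_def exp_of_nat_mult [symmetric] exp_add [symmetric])
    then show "g \<circ> int summable_on UNIV" using geo by simp
  qed auto
  have 2: "g summable_on range (\<lambda>n. - int n - 1)"
  proof (subst summable_on_reindex)
    have "g \<circ> (\<lambda>n. - int n - 1) = (\<lambda>n. exp (-1/2) * exp (-1::real) ^ n)"
      by (rule ext) (simp add: g_def exp_of_nat_mult [symmetric] exp_add [symmetric])
    then show "g \<circ> (\<lambda>n. - int n - 1) summable_on UNIV" using geo by simp
  qed (auto simp: inj_on_def)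
  have "m \<in> range int \<union> range (\<lambda>n. - int n - 1)" for m :: int
  proof (cases "m \<ge> 0")
    case True
    then have "m = int (nat m)" by simp
    then show ?thesis by blast
  next
    case False
    then have "m = - int (nat (- m - 1)) - 1" by simp
    then show ?thesis by blast
  qed
  then have "range int \<union> range (\<lambda>n. - int n - 1) = UNIV" by blast
  moreover have "g summable_on (range int \<union> range (\<lambda>n. - int n - 1))"
    by (rule summable_on_Un_disjoint [OF 1 2]) auto
  ultimately show ?thesis by (simp add: g_def)
qed

lemma theta11_term_bound:
  assumes t: "Im \<tau> > 0"
  obtains K where "\<And>m z. norm z \<le> R \<Longrightarrow>
    norm (exp (of_real pi * \<i> * ((of_int m + 1/2)\<^sup>2 * \<tau> + 2 * (of_int m + 1/2) * (z + 1/2))))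
      \<le> K * exp (- \<bar>of_int m + 1/2 :: real\<bar>)"
proof
  fix m :: int and z :: complex
  assume z: "norm z \<le> R"
  define x where "x = (of_int m + 1/2 :: real)"
  define B where "B = 1 + 2 * pi * R"
  have c: "(of_int m + 1/2 :: complex) = of_real x" by (simp add: x_def)
  have R: "\<bar>Im z\<bar> \<le> R" using abs_Im_le_cmod [of z] z by linarith
  have "norm (exp (of_real pi * \<i> * ((of_int m + 1/2)\<^sup>2 * \<tau> + 2 * (of_int m + 1/2) * (z + 1/2))))
      = exp (- pi * (x\<^sup>2 * Im \<tau> + 2 * x * Im z))"
    unfolding c by (simp add: power2_eq_square algebra_simps)
  also have "\<dots> \<le> exp (B\<^sup>2 / (4 * pi * Im \<tau>) - \<bar>x\<bar>)"
  proof -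
    have "- (x * Im z) \<le> \<bar>x\<bar> * \<bar>Im z\<bar>" by (metis abs_ge_minus_self abs_mult)
    also have "\<dots> \<le> \<bar>x\<bar> * R" using R by (intro mult_left_mono) auto
    finally have 1: "pi * (- (x * Im z)) \<le> pi * (\<bar>x\<bar> * R)" by (intro mult_left_mono) auto
    have "0 \<le> (2 * pi * Im \<tau> * \<bar>x\<bar> - B)\<^sup>2" by simp
    also have "\<dots> = 4 * pi * Im \<tau> * (pi * Im \<tau> * x\<^sup>2 - B * \<bar>x\<bar>) + B\<^sup>2"
      by (simp add: power2_eq_square algebra_simps)
    finally have "(B * \<bar>x\<bar> - pi * Im \<tau> * x\<^sup>2) * (4 * pi * Im \<tau>) \<le> B\<^sup>2"
      by (simp add: algebra_simps)
    moreover have "4 * pi * Im \<tau> > 0" using t by simp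
    ultimately have "B * \<bar>x\<bar> - pi * Im \<tau> * x\<^sup>2 \<le> B\<^sup>2 / (4 * pi * Im \<tau>)"
      by (simp only: pos_le_divide_eq)
    with 1 show ?thesis by (simp add: B_def algebra_simps)
  qed
  also have "\<dots> = exp (B\<^sup>2 / (4 * pi * Im \<tau>)) * exp (- \<bar>x\<bar>)"
    by (simp add: exp_add [symmetric])
  finally show "norm (exp (of_real pi * \<i> *
        ((of_int m + 1/2)\<^sup>2 * \<tau> + 2 * (of_int m + 1/2) * (z + 1/2))))
      \<le> exp ((1 + 2 * pi * R)\<^sup>2 / (4 * pi * Im \<tau>)) * exp (- \<bar>of_int m + 1/2 :: real\<bar>)"
    by (simp add: x_def B_def)
qed

lemma theta11_abs_summable:
  assumes "Im \<tau> > 0"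
  shows "(\<lambda>m::int. norm (exp (of_real pi * \<i> *
           ((of_int m + 1/2)\<^sup>2 * \<tau> + 2 * (of_int m + 1/2) * (z + 1/2))))) summable_on UNIV"
proof -
  obtain K where K: "\<And>m z'. norm z' \<le> norm z \<Longrightarrow>
    norm (exp (of_real pi * \<i> * ((of_int m + 1/2)\<^sup>2 * \<tau> + 2 * (of_int m + 1/2) * (z' + 1/2))))
      \<le> K * exp (- \<bar>of_int m + 1/2 :: real\<bar>)"
    using theta11_term_bound [OF assms, of "norm z"] by metis
  show ?thesis
    by (rule Infinite_Sum.abs_summable_on_comparison_test'
          [where g = "\<lambda>m. K * exp (- \<bar>of_int m + 1/2 :: real\<bar>)"])
       (use K in \<open>auto intro!: summable_on_cmult_right summable_on_exp_half_int\<close>)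
qed

lemma theta11_holomorphic:
  assumes "Im \<tau> > 0"
  shows "(\<lambda>z. theta11 z \<tau>) holomorphic_on UNIV"
proof -
  have "(\<lambda>z. theta11 z \<tau>) holomorphic_on ball 0 R" for R :: real
  proof -
    obtain K where K: "\<And>m z'. norm z' \<le> R \<Longrightarrow>
      norm (exp (of_real pi * \<i> * ((of_int m + 1/2)\<^sup>2 * \<tau> + 2 * (of_int m + 1/2) * (z' + 1/2))))
        \<le> K * exp (- \<bar>of_int m + 1/2 :: real\<bar>)"
      using theta11_term_bound [OF assms, of R] by metis
    have "uniform_limit (cball 0 R) (\<lambda>X z. \<Sum>m\<in>X. exp (of_real pi * \<i> *
             ((of_int m + 1/2)\<^sup>2 * \<tau> + 2 * (of_int m + 1/2) * (z + 1/2))))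
           (\<lambda>z. theta11 z \<tau>) (finite_subsets_at_top (UNIV :: int set))"
      unfolding theta11_def
      by (rule Weierstrass_m_test_general
            [where M = "\<lambda>m. K * exp (- \<bar>of_int m + 1/2 :: real\<bar>)"])
         (use K in \<open>auto intro!: summable_on_cmult_right summable_on_exp_half_int\<close>)
    then show ?thesis
      by (rule holomorphic_uniform_limit [rotated])
         (auto intro!: always_eventually holomorphic_intros continuous_intros)
  qed
  then have "(\<lambda>z. theta11 z \<tau>) holomorphic_on (\<Union>R. ball 0 R)"
    by (intro holomorphic_on_UN_open) auto
  moreover have "(\<Union>R. ball (0::complex) R) = UNIV"
    by (auto intro: gt_ex)
  ultimately show ?thesis by simp
qed

lemma F_series_in_entire_fps:
  assumes "Im \<tau> > 0"
  shows "F_series \<tau> \<in> entire_fps"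
proof -
  have "(\<lambda>z. theta11 (fact n * z) \<tau>) holomorphic_on UNIV" for n :: nat
    using holomorphic_on_compose_gen
            [of "\<lambda>z. fact n * z" UNIV "\<lambda>z. theta11 z \<tau>" UNIV, OF _ theta11_holomorphic [OF assms]]
    by (auto simp: o_def intro!: holomorphic_intros)
  then have "f_coeff \<tau> n holomorphic_on UNIV" for n
    unfolding f_coeff_def [abs_def] by (cases "n = 0") (auto intro!: holomorphic_intros)
  then show ?thesis by (simp add: entire_fps_def F_series_def)
qed

end

theory Submission
  imports Defs "HOL-Real_Asymp.Real_Asymp"
begin

text \<open>
  By Jacobi's triple product and quasi-periodicity, \<open>|\<theta>\<^sub>1\<^sub>1(z)|\<close> bounds the distance of \<open>z\<close> to the
  lattice \<open>\<int>\<tau> + \<int>\<close> up to a constant factor: after translating \<open>z\<close> to \<open>|Im z| \<le> Im \<tau> / 2\<close>, which does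
  not increase \<open>|\<theta>\<^sub>1\<^sub>1|\<close>, every factor of the product except the one vanishing at the
  lattice points is bounded below by a convergent product independent of \<open>z\<close>.
  If the series converged for some \<open>w \<noteq> 0\<close>, the distance of \<open>n! z\<^sub>0\<close> to the lattice would
  therefore be \<open>O(2\<^sup>-\<^sup>n)\<close>. But a nonzero displacement is multiplied by \<open>n + 1\<close> when passing
  from \<open>n!\<close> to \<open>(n + 1)!\<close>, so \<open>n! z\<^sub>0\<close> would be a lattice point for large \<open>n\<close>.
\<close>

subsection \<open>Gaussian binomial coefficients\<close>

text \<open>The q-Pochhammer symbol \<open>(q; q)_n\<close>.\<close>

definition qpoch :: "'a :: comm_ring_1 \<Rightarrow> nat \<Rightarrow> 'a" where
  "qpoch q n = (\<Prod>k<n. 1 - q ^ Suc k)"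

lemma qpoch_0 [simp]: "qpoch q 0 = 1"
  by (simp add: qpoch_def)

lemma qpoch_Suc: "qpoch q (Suc n) = qpoch q n * (1 - q ^ Suc n)"
  by (simp add: qpoch_def)

lemma one_minus_power_nonzero:
  fixes q :: "'a :: real_normed_field"
  assumes "norm q < 1"
  shows "1 - q ^ Suc k \<noteq> 0"
proof
  assume "1 - q ^ Suc k = 0"
  then have "norm q ^ Suc k = 1"
    by (metis eq_iff_diff_eq_0 norm_one norm_power)
  moreover have "norm q ^ Suc k < 1"
    using assms mult_left_le [of "norm q ^ k" "norm q"] by (simp add: power_le_one)
  ultimately show False by simp
qed

lemma qpoch_nonzero:
  fixes q :: "'a :: real_normed_field"
  assumes "norm q < 1"
  shows "qpoch q n \<noteq> 0"
  using one_minus_power_nonzero [OF assms] by (simp add: qpoch_def)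

text \<open>The geometric series makes the product absolutely convergent, and a convergent product
  without zero factors has a nonzero value.\<close>

lemma qpoch_tendsto:
  fixes q :: "'a :: {real_normed_field, banach}"
  assumes "norm q < 1"
  obtains C where "C \<noteq> 0" "qpoch q \<longlonglongrightarrow> C"
proof
  have "summable (\<lambda>k. norm (q ^ Suc k))"
    using assms by (simp add: norm_mult norm_power summable_mult)
  then have conv: "convergent_prod (\<lambda>k. 1 - q ^ Suc k)"
    by (intro abs_convergent_prod_imp_convergent_prod summable_imp_abs_convergent_prod) simp
  show "prodinf (\<lambda>k. 1 - q ^ Suc k) \<noteq> 0"
    by (rule prodinf_nonzero [OF conv one_minus_power_nonzero [OF assms]])
  have "(\<lambda>n. qpoch q (Suc n)) \<longlonglongrightarrow> prodinf (\<lambda>k. 1 - q ^ Suc k)"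
    using convergent_prod_LIMSEQ [OF conv]
    by (simp add: qpoch_def lessThan_Suc_atMost del: power_Suc prod.lessThan_Suc)
  then show "qpoch q \<longlonglongrightarrow> prodinf (\<lambda>k. 1 - q ^ Suc k)"
    by (rule LIMSEQ_imp_Suc)
qed

text \<open>Since the limit is nonzero, the reciprocals converge too and are therefore
  bounded.\<close>

lemma qpoch_norm_lower_bound:
  fixes q :: "'a :: {real_normed_field, banach}"
  assumes "norm q < 1"
  obtains c where "c > 0" "\<And>n. c \<le> norm (qpoch q n)"
proof -
  obtain C where C: "C \<noteq> 0" "qpoch q \<longlonglongrightarrow> C"
    using qpoch_tendsto [OF assms] .
  have "(\<lambda>n. inverse (qpoch q n)) \<longlonglongrightarrow> inverse C"
    using C by (intro tendsto_inverse)
  then have "Bseq (\<lambda>n. inverse (qpoch q n))"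
    by (intro convergent_imp_Bseq convergentI)
  then obtain K where K: "K > 0" "\<And>n. norm (inverse (qpoch q n)) \<le> K"
    by (auto elim: BseqE)
  have "inverse K \<le> norm (qpoch q n)" for n
    using le_imp_inverse_le [OF K(2) [of n]] qpoch_nonzero [OF assms, of n]
    by (simp add: norm_inverse)
  with K(1) show ?thesis by (intro that [of "inverse K"]) auto
qed

text \<open>The value 0 for \<open>k > n\<close> keeps Pascal's rule valid at the edge
  \<open>k = n\<close>.\<close>

definition qbinomial :: "'a :: field \<Rightarrow> nat \<Rightarrow> nat \<Rightarrow> 'a" where
  "qbinomial q n k = (if k \<le> n then qpoch q n / (qpoch q k * qpoch q (n - k)) else 0)"

lemma qbinomial_0_right:
  fixes q :: "'a :: real_normed_field"
  assumes "norm q < 1"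
  shows "qbinomial q n 0 = 1"
  using qpoch_nonzero [OF assms] by (simp add: qbinomial_def)

text \<open>For \<open>k < n\<close>, put \<open>x = q ^ Suc k\<close> and
  \<open>y = q ^ (n - k)\<close>; cancelling common factors leaves
  \<open>1 - x * y = (1 - y) + y * (1 - x)\<close>.\<close>

lemma qbinomial_pascal:
  fixes q :: "'a :: real_normed_field"
  assumes "norm q < 1"
  shows "qbinomial q (Suc n) (Suc k) = qbinomial q n (Suc k) + q ^ (n - k) * qbinomial q n k"
proof -
  consider "k > n" | "k = n" | d where "n = Suc (k + d)"
    using less_imp_Suc_add by (metis linorder_neqE_nat)
  then show ?thesis
  proof cases
    case 3
    define a b c where "a = qpoch q n" and "b = qpoch q k" and "c = qpoch q d"
    define x y where "x = q ^ Suc k" and "y = q ^ Suc d"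
    have nz: "a \<noteq> 0" "b \<noteq> 0" "c \<noteq> 0" "1 - x \<noteq> 0" "1 - y \<noteq> 0"
      using qpoch_nonzero [OF assms] one_minus_power_nonzero [OF assms]
      by (auto simp: a_def b_def c_def x_def y_def)
    have "q ^ Suc n = x * y"
      by (simp add: x_def y_def 3 power_add)
    then have "qbinomial q (Suc n) (Suc k) = a * (1 - x * y) / (b * (1 - x) * (c * (1 - y)))"
      by (simp add: qbinomial_def 3 qpoch_Suc a_def b_def c_def x_def y_def)
    moreover have "qbinomial q n (Suc k) = a / (b * (1 - x) * c)"
      by (simp add: qbinomial_def 3 qpoch_Suc a_def b_def c_def x_def y_def)
    moreover have "q ^ (n - k) * qbinomial q n k = y * (a / (b * (c * (1 - y))))"
      by (simp add: qbinomial_def 3 qpoch_Suc a_def b_def c_def x_def y_def)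
    moreover have "a * (1 - x * y) / (b * (1 - x) * (c * (1 - y))) =
        a / (b * (1 - x) * c) + y * (a / (b * (c * (1 - y))))"
      using nz by (simp add: divide_simps) (simp add: algebra_simps)
    ultimately show ?thesis by simp
  qed (use qpoch_nonzero [OF assms] in \<open>auto simp: qbinomial_def\<close>)
qed

text \<open>Gauss's q-binomial theorem, by induction with Pascal's rule. Prescribing the ratios of
  \<open>T\<close> encodes the usual powers of \<open>q\<close> with quadratic exponent and fits the
  theta terms directly.\<close>

lemma gauss_qbinomial_sum:
  fixes q x :: "'a :: real_normed_field"
  assumes q: "norm q < 1" and T: "\<And>k. T (Suc k) = T k * (x * q ^ k)"
  shows "(\<Sum>k\<le>n. qbinomial q n k * T k) = T 0 * (\<Prod>k<n. 1 + x * q ^ k)"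
proof (induction n)
  case 0
  then show ?case by (simp add: qbinomial_def)
next
  case (Suc n)
  have "(\<Sum>k\<le>Suc n. qbinomial q (Suc n) k * T k) =
      T 0 + (\<Sum>k\<le>n. qbinomial q n (Suc k) * T (Suc k))
        + (\<Sum>k\<le>n. q ^ (n - k) * qbinomial q n k * T (Suc k))"
    unfolding sum.atMost_Suc_shift qbinomial_pascal [OF q] distrib_right sum.distrib
    by (simp add: qbinomial_0_right [OF q])
  also have "T 0 + (\<Sum>k\<le>n. qbinomial q n (Suc k) * T (Suc k)) = (\<Sum>k\<le>Suc n. qbinomial q n k * T k)"
    unfolding sum.atMost_Suc_shift by (simp add: qbinomial_0_right [OF q])
  also have "\<dots> = (\<Sum>k\<le>n. qbinomial q n k * T k)"
    by (simp add: qbinomial_def)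
  \<comment> \<open>The \<open>q ^ (n - k)\<close> of Pascal's rule and the \<open>q ^ k\<close> of
    the ratio combine to \<open>q ^ n\<close>, so the new factor \<open>1 + x * q ^ n\<close> splits
    off.\<close>
  also have "(\<Sum>k\<le>n. q ^ (n - k) * qbinomial q n k * T (Suc k)) =
      (\<Sum>k\<le>n. qbinomial q n k * T k) * (x * q ^ n)"
    unfolding sum_distrib_right
  proof (rule sum.cong)
    fix k assume "k \<in> {..n}"
    then have "q ^ (n - k) * q ^ k = q ^ n"
      by (simp flip: power_add)
    moreover have "q ^ (n - k) * qbinomial q n k * T (Suc k) =
        qbinomial q n k * T k * (x * (q ^ (n - k) * q ^ k))"
      unfolding T by (simp only: mult_ac)
    ultimately show "q ^ (n - k) * qbinomial q n k * T (Suc k) = qbinomial q n k * T k * (x * q ^ n)"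
      by simp
  qed simp
  finally show ?case
    unfolding Suc.IH by (simp add: algebra_simps)
qed

subsection \<open>The triple product\<close>

lemma prod_lessThan_add:
  fixes f :: "nat \<Rightarrow> 'a :: comm_monoid_mult"
  shows "(\<Prod>k<m+n. f k) = (\<Prod>k<m. f k) * (\<Prod>k<n. f (m + k))"
  by (induction n) (simp_all add: mult.assoc)

definition theta_term :: "complex \<Rightarrow> complex \<Rightarrow> int \<Rightarrow> complex" where
  "theta_term \<tau> z m =
     exp (of_real pi * \<i> * ((of_int m + 1/2)\<^sup>2 * \<tau> + 2 * (of_int m + 1/2) * (z + 1/2)))"

definition nome_sq :: "complex \<Rightarrow> complex" where
  "nome_sq \<tau> = exp (2 * of_real pi * \<i> * \<tau>)"

lemma norm_nome_sq: "norm (nome_sq \<tau>) = exp (- 2 * pi * Im \<tau>)"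
  by (simp add: nome_sq_def)

lemma norm_nome_sq_less_1: "Im \<tau> > 0 \<Longrightarrow> norm (nome_sq \<tau>) < 1"
  by (simp add: norm_nome_sq)

lemma nome_sq_power: "nome_sq \<tau> ^ k = exp (2 * of_real pi * \<i> * (of_nat k * \<tau>))"
  by (simp add: nome_sq_def algebra_simps flip: exp_of_nat_mult)

lemma exp_pi_i_odd: "exp (of_real pi * \<i> * (z + 1)) = - exp (of_real pi * \<i> * z)"
  by (simp add: algebra_simps exp_add)


text \<open>The squares of consecutive half-integers differ by \<open>2 * (m + 1)\<close>, so the
  ratios of consecutive terms form a geometric progression, as \<open>gauss_qbinomial_sum\<close>
  requires. The sign comes from the shift in \<open>z + 1/2\<close>.\<close>

lemma theta_term_Suc:
  "theta_term \<tau> z (m + 1) =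
     theta_term \<tau> z m * - exp (2 * of_real pi * \<i> * (z + (of_int m + 1) * \<tau>))"
proof -
  have "- exp (2 * of_real pi * \<i> * (z + (of_int m + 1) * \<tau>)) =
      exp (of_real pi * \<i> * (2 * (z + (of_int m + 1) * \<tau>) + 1))"
    unfolding exp_pi_i_odd by (simp add: algebra_simps)
  then show ?thesis
    unfolding theta_term_def by (simp add: power2_eq_square algebra_simps flip: exp_add)
qed

text \<open>Gauss's theorem for \<open>2*n\<close>, centred at the theta term of index 0: half of
  the factors give the product in \<open>w\<close>, the other half the product in
  \<open>1 / w\<close>.\<close>

lemma finite_triple_product:
  fixes \<tau> z :: complex
  assumes "Im \<tau> > 0"
  defines "q \<equiv> nome_sq \<tau>" and "w \<equiv> exp (2 * of_real pi * \<i> * z)"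
  shows "(\<Sum>k\<le>2*n. qbinomial q (2*n) k * theta_term \<tau> z (int k - int n)) =
    theta_term \<tau> z 0 * (\<Prod>k<n. 1 - q ^ Suc k * w) * (\<Prod>k<n. 1 - q ^ k / w)"
proof -
  \<comment> \<open>Chosen so that \<open>x * q ^ k\<close> is the ratio of the theta terms at
    \<open>k - n + 1\<close> and \<open>k - n\<close>.\<close>
  define x where "x = - exp (2 * of_real pi * \<i> * (z + (1 - of_nat n) * \<tau>))"
  define T where "T = (\<lambda>k. theta_term \<tau> z (int k - int n))"
  have q: "norm q < 1" and q0: "q \<noteq> 0" and w0: "w \<noteq> 0"
    using norm_nome_sq_less_1 [OF assms(1)] by (auto simp: q_def w_def nome_sq_def)
  have T: "T (Suc k) = T k * (x * q ^ k)" for k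
    using theta_term_Suc [of \<tau> z "int k - int n"]
    by (simp add: T_def x_def q_def nome_sq_power algebra_simps flip: exp_add)
  have "x * q ^ n = - exp (2 * of_real pi * \<i> * (z + \<tau>))"
    by (simp add: x_def q_def nome_sq_power algebra_simps flip: exp_add)
  also have "exp (2 * of_real pi * \<i> * (z + \<tau>)) = q * w"
    unfolding q_def w_def nome_sq_def exp_add [symmetric] by (simp add: algebra_simps)
  finally have xq: "x * q ^ n = - (q * w)" .
  have T0: "T m = T 0 * (\<Prod>k<m. x * q ^ k)" for m
    by (induction m) (simp_all add: T)
  have "x * q ^ k \<noteq> 0" for k
    using q0 by (simp add: x_def)
  then have "1 + x * q ^ k = x * q ^ k * (1 + 1 / (x * q ^ k))" for k
    by (simp add: field_simps)
  \<comment> \<open>Pulling \<open>x * q ^ k\<close> out of each of the first \<open>n\<close>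
    factors carries \<open>T 0\<close>, the term at \<open>- n\<close>, to \<open>T n\<close>, the
    term at 0.\<close>
  then have "T 0 * (\<Prod>k<n. 1 + x * q ^ k) = T 0 * (\<Prod>k<n. x * q ^ k) * (\<Prod>k<n. 1 + 1 / (x * q ^ k))"
    by (metis (no_types, lifting) prod.cong prod.distrib mult.assoc)
  also have "\<dots> = theta_term \<tau> z 0 * (\<Prod>k<n. 1 + 1 / (x * q ^ k))"
    unfolding T0 [symmetric] by (simp add: T_def)
  \<comment> \<open>Reversing the order counts from the centre, where
    \<open>x * q ^ n = - (q * w)\<close>.\<close>
  also have "(\<Prod>k<n. 1 + 1 / (x * q ^ k)) = (\<Prod>k<n. 1 + 1 / (x * q ^ (n - Suc k)))"
    by (rule prod.nat_diff_reindex [symmetric])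
  also have "\<dots> = (\<Prod>k<n. 1 - q ^ k / w)"
  proof (intro prod.cong refl)
    fix k assume "k \<in> {..<n}"
    then have "q ^ (n - Suc k) * (q ^ Suc k) = q ^ n"
      by (simp flip: power_add del: power_Suc)
    then have "x * q ^ (n - Suc k) * q ^ Suc k = - (q * w)"
      using xq by (simp only: mult.assoc)
    then have "q * (x * q ^ (n - Suc k) * q ^ k) = q * (- w)"
      by (simp add: mult_ac)
    then have "x * q ^ (n - Suc k) * q ^ k = - w"
      by (simp only: mult_left_cancel [OF q0])
    then have "x * q ^ (n - Suc k) = - w / q ^ k"
      using q0 by (simp add: divide_simps)
    then show "1 + 1 / (x * q ^ (n - Suc k)) = 1 - q ^ k / w"
      by simp
  qed
  finally have 1: "T 0 * (\<Prod>k<n. 1 + x * q ^ k) = theta_term \<tau> z 0 * (\<Prod>k<n. 1 - q ^ k / w)" .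
  have "x * q ^ (n + k) = - (q ^ Suc k * w)" for k
    unfolding power_add mult.assoc [symmetric] xq by (simp add: mult_ac)
  then have 2: "(\<Prod>k<n. 1 + x * q ^ (n + k)) = (\<Prod>k<n. 1 - q ^ Suc k * w)"
    by simp
  have "(\<Sum>k\<le>2*n. qbinomial q (2*n) k * T k) = T 0 * (\<Prod>k<2*n. 1 + x * q ^ k)"
    by (rule gauss_qbinomial_sum [OF q T])
  also have "(\<Prod>k<2*n. 1 + x * q ^ k) = (\<Prod>k<n. 1 + x * q ^ k) * (\<Prod>k<n. 1 + x * q ^ (n + k))"
    unfolding mult_2 by (rule prod_lessThan_add)
  finally have "(\<Sum>k\<le>2*n. qbinomial q (2*n) k * T k) =
      T 0 * (\<Prod>k<n. 1 + x * q ^ k) * (\<Prod>k<n. 1 + x * q ^ (n + k))"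
    by (simp only: mult.assoc)
  then show ?thesis
    unfolding 1 2 unfolding T_def by (simp only: mult_ac)
qed

section \<open>Passage to the limit in the finite triple product\<close>

lemma qbinomial_central_tendsto:
  fixes q :: "'a :: {real_normed_field, banach}"
  assumes q: "norm q < 1" and C: "C \<noteq> 0" "qpoch q \<longlonglongrightarrow> C"
  shows "(\<lambda>n. if \<bar>m\<bar> \<le> int n then qbinomial q (2*n) (nat (m + int n)) else 0) \<longlonglongrightarrow> 1 / C"
proof -
  have "filterlim (\<lambda>n. nat (m + int n)) at_top sequentially" for m
    unfolding filterlim_at_top eventually_sequentially
    by (intro allI, rule_tac x = "nat (\<bar>m\<bar> + int Z)" in exI) auto
  then have lim: "(\<lambda>n. qpoch q (nat (m + int n))) \<longlonglongrightarrow> C" for m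
    by (rule filterlim_compose [OF C(2)])
  have "(\<lambda>n. qpoch q (2 * n)) \<longlonglongrightarrow> C"
    by (rule filterlim_compose [OF C(2)]) (simp add: filterlim_subseq strict_mono_def)
  \<comment> \<open>For fixed \<open>m\<close> all three indices tend to infinity, so each symbol
    tends to \<open>C\<close>.\<close>
  then have "(\<lambda>n. qpoch q (2*n) / (qpoch q (nat (m + int n)) * qpoch q (nat (- m + int n))))
      \<longlonglongrightarrow> C / (C * C)"
    using C(1) by (intro tendsto_divide tendsto_mult lim) auto
  moreover have "\<forall>\<^sub>F n in sequentially.
      qpoch q (2*n) / (qpoch q (nat (m + int n)) * qpoch q (nat (- m + int n))) =
      (if \<bar>m\<bar> \<le> int n then qbinomial q (2*n) (nat (m + int n)) else 0)"
    using eventually_ge_at_top [of "nat \<bar>m\<bar>"]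
  proof eventually_elim
    case (elim n)
    then have "nat (m + int n) \<le> 2 * n" "2 * n - nat (m + int n) = nat (- m + int n)" "\<bar>m\<bar> \<le> int n"
      by auto
    then show ?case by (simp add: qbinomial_def)
  qed
  ultimately have "(\<lambda>n. if \<bar>m\<bar> \<le> int n then qbinomial q (2*n) (nat (m + int n)) else 0)
      \<longlonglongrightarrow> C / (C * C)"
    by (rule Lim_transform_eventually)
  then show ?thesis
    using C(1) by simp
qed

text \<open>Supplies the majorant for the passage to the limit: numerators are bounded, and
  denominators stay away from 0.\<close>

lemma qbinomial_norm_bound:
  fixes q :: "'a :: {real_normed_field, banach}"
  assumes q: "norm q < 1"
  obtains M where "M > 0" "\<And>n k. norm (qbinomial q n k) \<le> M"
proof -
  obtain C where C: "C \<noteq> 0" "qpoch q \<longlonglongrightarrow> C"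
    using qpoch_tendsto [OF q] .
  then have "Bseq (qpoch q)"
    by (intro convergent_imp_Bseq convergentI)
  then obtain K where K: "K > 0" "\<And>n. norm (qpoch q n) \<le> K"
    by (auto elim: BseqE)
  obtain c where c: "c > 0" "\<And>n. c \<le> norm (qpoch q n)"
    using qpoch_norm_lower_bound [OF q] by blast
  show ?thesis
  proof (rule that)
    show "K / (c * c) > 0" using K c by simp
    show "norm (qbinomial q n k) \<le> K / (c * c)" for n k
    proof (cases "k \<le> n")
      case True
      have "c * c \<le> norm (qpoch q k) * norm (qpoch q (n - k))"
        by (rule mult_mono) (use c in auto)
      then have "norm (qpoch q n) / (norm (qpoch q k) * norm (qpoch q (n - k))) \<le> K / (c * c)"
        by (intro frac_le) (use K c in auto)
      then show ?thesis
        using True by (simp add: qbinomial_def norm_divide norm_mult)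
    qed (use K c in \<open>auto simp: qbinomial_def\<close>)
  qed
qed

text \<open>Jacobi's triple product, with the infinite product kept as a limit: dominated
  convergence in the finite identity, whose weights tend to \<open>1 / C\<close>.\<close>

lemma finite_triple_product_tendsto:
  fixes \<tau> z :: complex
  assumes \<tau>: "Im \<tau> > 0"
  defines "q \<equiv> nome_sq \<tau>" and "w \<equiv> exp (2 * of_real pi * \<i> * z)"
  assumes C: "C \<noteq> 0" "qpoch q \<longlonglongrightarrow> C"
  shows "(\<lambda>n. theta_term \<tau> z 0 * (\<Prod>k<n. 1 - q ^ Suc k * w) * (\<Prod>k<n. 1 - q ^ k / w))
    \<longlonglongrightarrow> theta11 z \<tau> / C"
proof -
  have q: "norm q < 1"
    using norm_nome_sq_less_1 [OF \<tau>] by (simp add: q_def)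
  obtain M where M: "M > 0" "\<And>n k. norm (qbinomial q n k) \<le> M"
    using qbinomial_norm_bound [OF q] by blast
  have abs_sum: "(\<lambda>m. norm (theta_term \<tau> z m)) summable_on UNIV"
    using theta11_abs_summable [OF \<tau>, of z] by (simp add: theta_term_def)
  have theta: "theta11 z \<tau> = (\<Sum>\<^sub>\<infinity>m. theta_term \<tau> z m)"
    by (simp add: theta11_def theta_term_def)
  \<comment> \<open>The guard matters for \<open>m < - n\<close>: there \<open>nat\<close> would
    truncate the index to 0, where the Gaussian binomial is 1.\<close>
  define a where "a = (\<lambda>m n. (if \<bar>m\<bar> \<le> int n then qbinomial q (2*n) (nat (m + int n)) else 0)
    * theta_term \<tau> z m)"
  have "(\<lambda>n. \<Sum>\<^sub>\<infinity>m. a m n) \<longlonglongrightarrow> theta11 z \<tau> / C"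
  \<comment> \<open>The M-test is uniform in \<open>n\<close>, which permits exchanging the limit in
    \<open>n\<close> with the sum over \<open>m\<close>.\<close>
  proof (rule swap_uniform_limit')
    show "uniform_limit UNIV (\<lambda>X n. \<Sum>m\<in>X. a m n) (\<lambda>n. \<Sum>\<^sub>\<infinity>m. a m n) (finite_subsets_at_top UNIV)"
    proof (rule Weierstrass_m_test_general)
      show "(\<lambda>m. M * norm (theta_term \<tau> z m)) summable_on UNIV"
        by (intro summable_on_cmult_right abs_sum)
      show "norm (a m n) \<le> M * norm (theta_term \<tau> z m)" for m n
        using M by (auto simp: a_def norm_mult intro!: mult_right_mono)
    qed
    show "\<forall>\<^sub>F X in finite_subsets_at_top UNIV.
        ((\<lambda>n. \<Sum>m\<in>X. a m n) \<longlonglongrightarrow> (\<Sum>m\<in>X. 1 / C * theta_term \<tau> z m))"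
      unfolding a_def
      by (intro always_eventually allI tendsto_sum tendsto_mult_right
          qbinomial_central_tendsto [OF q C])
    have "((\<lambda>X. 1 / C * (\<Sum>m\<in>X. theta_term \<tau> z m)) \<longlongrightarrow> 1 / C * theta11 z \<tau>)
        (finite_subsets_at_top UNIV)"
      unfolding theta
      by (intro tendsto_mult_left infsum_tendsto abs_summable_summable [OF abs_sum])
    then show "((\<lambda>X. \<Sum>m\<in>X. 1 / C * theta_term \<tau> z m) \<longlongrightarrow> theta11 z \<tau> / C)
        (finite_subsets_at_top UNIV)"
      by (simp add: sum_divide_distrib)
  qed auto
  moreover have "(\<Sum>\<^sub>\<infinity>m. a m n) =
      theta_term \<tau> z 0 * (\<Prod>k<n. 1 - q ^ Suc k * w) * (\<Prod>k<n. 1 - q ^ k / w)" for n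
  proof -
    have "(\<Sum>\<^sub>\<infinity>m. a m n) = (\<Sum>\<^sub>\<infinity>m\<in>{- int n..int n}. a m n)"
      by (rule infsum_cong_neutral) (auto simp: a_def)
    also have "\<dots> = (\<Sum>m\<in>{- int n..int n}. a m n)"
      by simp
    also have "\<dots> = (\<Sum>k\<le>2*n. qbinomial q (2*n) k * theta_term \<tau> z (int k - int n))"
      by (rule sum.reindex_bij_witness
            [where i = "\<lambda>k. int k - int n" and j = "\<lambda>m. nat (m + int n)"])
         (auto simp: a_def)
    also have "\<dots> = theta_term \<tau> z 0 * (\<Prod>k<n. 1 - q ^ Suc k * w) * (\<Prod>k<n. 1 - q ^ k / w)"
      unfolding q_def w_def by (rule finite_triple_product [OF \<tau>])
    finally show ?thesis .
  qed
  ultimately show ?thesis by (simp only:)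
qed

subsection \<open>Small values of the theta function\<close>

text \<open>Factor by factor, the reverse triangle inequality gives
  \<open>norm (1 - a k) \<ge> 1 - r ^ Suc k \<ge> 0\<close>.\<close>

lemma qpoch_le_norm_prod:
  fixes a :: "nat \<Rightarrow> complex"
  assumes "\<And>k. norm (a k) \<le> r ^ Suc k" "0 \<le> r" "r < 1"
  shows "qpoch r n \<le> norm (\<Prod>k<n. 1 - a k)"
proof -
  have "0 \<le> 1 - r ^ Suc k \<and> 1 - r ^ Suc k \<le> norm (1 - a k)" for k
    using assms(1) [of k] norm_triangle_ineq2 [of 1 "a k"] power_le_one [of r "Suc k"] assms(2,3)
    by auto
  then show ?thesis
    unfolding qpoch_def prod_norm [symmetric] by (intro prod_mono) auto
qed

text \<open>In the strip the exponential is at most \<open>exp (pi * Im \<tau>)\<close> in norm,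
  which costs half of the decay of one factor \<open>nome_sq \<tau>\<close>; this leaves at least
  half of the total decay.\<close>

lemma norm_nome_sq_power_mult_le:
  assumes "Im \<tau> > 0" "\<bar>Im z\<bar> \<le> Im \<tau> / 2"
  shows "norm (nome_sq \<tau> ^ Suc k * exp (2 * of_real pi * \<i> * z)) \<le> exp (- pi * Im \<tau>) ^ Suc k"
proof -
  have "norm (nome_sq \<tau> ^ Suc k * exp (2 * of_real pi * \<i> * z)) =
      exp (pi * (- 2 * real (Suc k) * Im \<tau> - 2 * Im z))"
    unfolding nome_sq_power norm_mult by (simp add: algebra_simps flip: exp_add)
  also have "\<dots> \<le> exp (pi * (- real (Suc k) * Im \<tau>))"
  proof -
    have "0 \<le> real k * Im \<tau>" "- 2 * Im z \<le> Im \<tau>"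
      using assms by auto
    then have "- 2 * Im z \<le> real (Suc k) * Im \<tau>"
      by (simp add: algebra_simps)
    then show ?thesis
      unfolding exp_le_cancel_iff by (intro mult_left_mono) (auto simp: algebra_simps)
  qed
  also have "\<dots> = exp (- pi * Im \<tau>) ^ Suc k"
    unfolding exp_of_nat_mult [symmetric] by (simp add: algebra_simps)
  finally show ?thesis .
qed

lemma theta11_lower_bound:
  assumes \<tau>: "Im \<tau> > 0"
  obtains c where "c > 0"
    "\<And>z. \<bar>Im z\<bar> \<le> Im \<tau> / 2 \<Longrightarrow> c * norm (1 - exp (- (2 * of_real pi * \<i> * z))) \<le> norm (theta11 z \<tau>)"
proof -
  define q where "q = nome_sq \<tau>"
  define r where "r = exp (- pi * Im \<tau>)"
  have r: "0 \<le> r" "r < 1" and "norm r < 1"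
    using \<tau> by (auto simp: r_def)
  have "norm q < 1"
    using norm_nome_sq_less_1 [OF \<tau>] by (simp add: q_def)
  then obtain C where C: "C \<noteq> 0" "qpoch q \<longlonglongrightarrow> C"
    using qpoch_tendsto by blast
  obtain d where d: "d > 0" "\<And>n. d \<le> norm (qpoch r n)"
    using qpoch_norm_lower_bound [OF \<open>norm r < 1\<close>] by blast
  have "qpoch r n \<ge> 0" for n
    using r by (auto simp: qpoch_def power_le_one simp del: power_Suc intro!: prod_nonneg)
  with d(2) have d': "d \<le> qpoch r n" for n
    by (metis abs_of_nonneg real_norm_def)
  \<comment> \<open>On the strip the first theta term has norm
    \<open>exp (- pi * (Im \<tau> / 4 + Im z))\<close> with \<open>Im \<tau> / 4 + Im z\<close> at
    most \<open>3/4 * Im \<tau>\<close>; 5/4 leaves room.\<close>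
  define B where "B = exp (- (5/4 * pi * Im \<tau>))"
  show ?thesis
  proof (rule that)
    show "norm C * (B * d * d) > 0"
      using C d by (simp add: B_def)
    fix z assume z: "\<bar>Im z\<bar> \<le> Im \<tau> / 2"
    define w where "w = exp (2 * of_real pi * \<i> * z)"
    have inv_w: "x / w = x * exp (2 * of_real pi * \<i> * (- z))" for x
      by (simp add: w_def exp_minus field_simps)
    have term0: "B \<le> norm (theta_term \<tau> z 0)"
    proof -
      have "norm (theta_term \<tau> z 0) = exp (- (pi * (Im \<tau> / 4 + Im z)))"
        by (simp add: theta_term_def power2_eq_square algebra_simps)
      moreover have "pi * (Im \<tau> / 4 + Im z) \<le> pi * (5/4 * Im \<tau>)"
        using z \<tau> by (intro mult_left_mono) auto
      ultimately show ?thesis by (simp add: B_def)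
    qed
    have P1: "d \<le> norm (\<Prod>k<n. 1 - q ^ Suc k * w)" for n
      unfolding w_def q_def
      by (rule order_trans [OF d' qpoch_le_norm_prod])
         (use norm_nome_sq_power_mult_le [OF \<tau> z] r in \<open>simp_all add: r_def\<close>)
    have P2: "d \<le> norm (\<Prod>k<n. 1 - q ^ Suc k / w)" for n
      unfolding inv_w q_def
      by (rule order_trans [OF d' qpoch_le_norm_prod])
         (use norm_nome_sq_power_mult_le [OF \<tau>, of "- z"] z r in \<open>simp_all add: r_def\<close>)
    define P where "P = (\<lambda>n. theta_term \<tau> z 0 * (\<Prod>k<n. 1 - q ^ Suc k * w) * (\<Prod>k<n. 1 - q ^ k / w))"
    have lower: "B * d * d * norm (1 - 1 / w) \<le> norm (P (Suc n))" for n
    proof -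
      \<comment> \<open>Taking \<open>Suc n\<close> factors exposes the critical factor
        \<open>1 - 1 / w\<close> at \<open>k = 0\<close>; the remaining exponents start at 1, as the
        comparison with \<open>qpoch r\<close> requires.\<close>
      have "P (Suc n) = theta_term \<tau> z 0 * (\<Prod>k<Suc n. 1 - q ^ Suc k * w) *
          (\<Prod>k<n. 1 - q ^ Suc k / w) * (1 - 1 / w)"
        unfolding P_def prod.lessThan_Suc_shift [of "\<lambda>k. 1 - q ^ k / w"] by simp
      then have "norm (P (Suc n)) = norm (theta_term \<tau> z 0) * norm (\<Prod>k<Suc n. 1 - q ^ Suc k * w) *
          norm (\<Prod>k<n. 1 - q ^ Suc k / w) * norm (1 - 1 / w)"
        by (simp only: norm_mult)
      moreover have "B * d * d * norm (1 - 1 / w) \<le> \<dots>"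
        using d(1) by (intro mult_mono term0 P1 P2) (auto simp: B_def)
      ultimately show ?thesis by simp
    qed
    have "P \<longlonglongrightarrow> theta11 z \<tau> / C"
      using finite_triple_product_tendsto [OF \<tau> C(1)] C(2) by (simp add: P_def q_def w_def)
    then have "(\<lambda>n. norm (P (Suc n))) \<longlonglongrightarrow> norm (theta11 z \<tau> / C)"
      by (intro tendsto_norm LIMSEQ_Suc)
    then have "B * d * d * norm (1 - 1 / w) \<le> norm (theta11 z \<tau> / C)"
      by (rule LIMSEQ_le_const) (use lower in blast)
    moreover have "1 / w = exp (- (2 * of_real pi * \<i> * z))"
      using inv_w [of 1] by simp
    ultimately show "norm C * (B * d * d) * norm (1 - exp (- (2 * of_real pi * \<i> * z)))
        \<le> norm (theta11 z \<tau>)"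
      using C(1) by (simp add: norm_divide field_simps)
  qed
qed

section \<open>Translation by lattice vectors\<close>

lemma theta11_quasi_periodic:
  "theta11 (z + of_int a * \<tau> + of_int b) \<tau> =
     exp (of_real pi * \<i> * (of_int b - (of_int a)\<^sup>2 * \<tau> - 2 * of_int a * (z + 1/2))) * theta11 z \<tau>"
proof -
  let ?E = "exp (of_real pi * \<i> * (of_int b - (of_int a)\<^sup>2 * \<tau> - 2 * of_int a * (z + 1/2)))"
  have term_eq: "theta_term \<tau> (z + of_int a * \<tau> + of_int b) m = ?E * theta_term \<tau> z (m + a)" for m
  proof -
    \<comment> \<open>Completing the square moves the index to \<open>m + a\<close>; in the phase
      \<open>(2 * m + 1) * b\<close>, the part \<open>2 * m * b\<close> contributes a factor
      1.\<close>
    have "theta_term \<tau> (z + of_int a * \<tau> + of_int b) m =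
        ?E * theta_term \<tau> z (m + a) * exp (of_real (2 * of_int (m * b) * pi) * \<i>)"
      unfolding theta_term_def exp_add [symmetric]
      by (rule arg_cong [where f = exp]) (simp add: power2_eq_square field_simps)
    also have "exp (of_real (2 * of_int (m * b) * pi) * \<i>) = 1"
      by (rule exp_integer_2pi) auto
    finally show ?thesis by simp
  qed
  have theta: "theta11 z \<tau> = (\<Sum>\<^sub>\<infinity>m. theta_term \<tau> z m)" for z
    by (simp add: theta11_def theta_term_def)
  have "bij (\<lambda>m. m + a)"
    by (rule bij_betw_byWitness [where f' = "\<lambda>m. m - a"]) auto
  then have "(\<Sum>\<^sub>\<infinity>m. theta_term \<tau> z (m + a)) = (\<Sum>\<^sub>\<infinity>m. theta_term \<tau> z m)"
    by (rule infsum_reindex_bij_betw)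
  then show ?thesis
    unfolding theta term_eq by (simp add: infsum_cmult_right')
qed

text \<open>The quasi-periodicity factor has norm at least 1, as \<open>2 * \<bar>a * Im z\<bar>
  \<le> \<bar>a\<bar> * Im \<tau> \<le> a\<^sup>2 * Im \<tau>\<close>; the last inequality uses that
  \<open>a\<close> is an integer.\<close>

lemma theta11_norm_le_translate:
  assumes "Im \<tau> > 0" "\<bar>Im z\<bar> \<le> Im \<tau> / 2"
  shows "norm (theta11 z \<tau>) \<le> norm (theta11 (z + of_int a * \<tau>) \<tau>)"
proof -
  have "norm (theta11 (z + of_int a * \<tau>) \<tau>) =
      exp (pi * ((of_int a)\<^sup>2 * Im \<tau> + 2 * of_int a * Im z)) * norm (theta11 z \<tau>)"
    using theta11_quasi_periodic [of z a \<tau> 0]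
    by (simp add: norm_mult power2_eq_square algebra_simps)
  moreover have "0 \<le> (of_int a)\<^sup>2 * Im \<tau> + 2 * of_int a * Im z"
  proof -
    have "\<bar>a\<bar> \<le> a\<^sup>2"
      using self_le_power [of "\<bar>a\<bar>" 2] by (cases "a = 0") auto
    then have "\<bar>of_int a :: real\<bar> \<le> (of_int a)\<^sup>2"
      by (metis of_int_abs of_int_le_iff of_int_power)
    then have "\<bar>of_int a\<bar> * Im \<tau> \<le> (of_int a)\<^sup>2 * Im \<tau>"
      using assms by (intro mult_right_mono) auto
    moreover have "\<bar>of_int a * Im z\<bar> \<le> \<bar>of_int a\<bar> * (Im \<tau> / 2)"
      unfolding abs_mult using assms by (intro mult_left_mono) auto
    ultimately show ?thesis by (simp add: abs_le_iff)
  qed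
  ultimately show ?thesis
    by (simp add: mult_right_le_one_le mult_le_cancel_right1)
qed

text \<open>Within 1/2 of 1, the norm of \<open>Ln\<close> is at most twice the distance from 1. The
  exponent differs from this logarithm by a multiple of \<open>2 * pi * \<i>\<close>, and dividing
  by \<open>2 * pi\<close> absorbs the factor 2.\<close>

lemma close_to_integer_if_exp_close_to_1:
  assumes "norm (1 - exp (- (2 * of_real pi * \<i> * z))) < 1/2"
  obtains b :: int where "norm (z - of_int b) \<le> norm (1 - exp (- (2 * of_real pi * \<i> * z)))"
proof -
  define u where "u = exp (- (2 * of_real pi * \<i> * z))"
  have "norm (Ln u) \<le> 2 * norm (1 - u)"
    using norm_Ln_le [of "u - 1"] assms by (simp add: u_def norm_minus_commute)
  have "exp (- (2 * of_real pi * \<i> * z)) = exp (Ln u)"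
    by (simp add: u_def)
  then obtain n :: int where "- (2 * of_real pi * \<i> * z) = Ln u + (of_int (2 * n) * pi) * \<i>"
    unfolding exp_eq by blast
  then have "2 * of_real pi * \<i> * z = - (Ln u + (of_int (2 * n) * pi) * \<i>)"
    by (metis minus_minus)
  then have "2 * of_real pi * \<i> * (z - of_int (- n)) = - Ln u"
    by (simp add: algebra_simps)
  then have "norm (2 * of_real pi * \<i> * (z - of_int (- n))) = norm (Ln u)"
    by simp
  then have "2 * pi * norm (z - of_int (- n)) \<le> 2 * norm (1 - u)"
    using \<open>norm (Ln u) \<le> _\<close> by (simp add: norm_mult)
  moreover have "2 * 1 * norm (z - of_int (- n)) \<le> 2 * pi * norm (z - of_int (- n))"
    using pi_ge_two by (intro mult_right_mono) auto
  ultimately show ?thesis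
    by (intro that [of "- n"]) (simp add: u_def)
qed

lemma close_to_lattice_if_theta11_small:
  assumes \<tau>: "Im \<tau> > 0"
  obtains K where "K > 0"
    "\<And>z. K * norm (theta11 z \<tau>) < 1/2 \<Longrightarrow>
      \<exists>a b :: int. norm (z - (of_int a * \<tau> + of_int b)) \<le> K * norm (theta11 z \<tau>)"
proof -
  obtain c where c: "c > 0"
    "\<And>z. \<bar>Im z\<bar> \<le> Im \<tau> / 2 \<Longrightarrow> c * norm (1 - exp (- (2 * of_real pi * \<i> * z))) \<le> norm (theta11 z \<tau>)"
    using theta11_lower_bound [OF \<tau>] by blast
  show ?thesis
  proof (rule that)
    show "1 / c > 0" using c(1) by simp
    fix z assume small: "1 / c * norm (theta11 z \<tau>) < 1/2"
    \<comment> \<open>Rounding to the nearest integer puts \<open>z'\<close> into the strip where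
      the lower bound holds.\<close>
    define a where "a = round (Im z / Im \<tau>)"
    define z' where "z' = z - of_int a * \<tau>"
    have "\<bar>Im z / Im \<tau> - of_int a\<bar> * Im \<tau> \<le> 1/2 * Im \<tau>"
      using of_int_round_abs_le [of "Im z / Im \<tau>"] \<tau>
      unfolding a_def by (intro mult_right_mono) (auto simp: abs_minus_commute)
    also have "\<bar>Im z / Im \<tau> - of_int a\<bar> * Im \<tau> = \<bar>(Im z / Im \<tau> - of_int a) * Im \<tau>\<bar>"
      using \<tau> by (simp add: abs_mult)
    also have "(Im z / Im \<tau> - of_int a) * Im \<tau> = Im z'"
      using \<tau> by (simp add: z'_def field_simps)
    finally have Im: "\<bar>Im z'\<bar> \<le> Im \<tau> / 2" by simp
    have "c * norm (1 - exp (- (2 * of_real pi * \<i> * z'))) \<le> norm (theta11 z' \<tau>)"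
      by (rule c(2) [OF Im])
    also have "\<dots> \<le> norm (theta11 z \<tau>)"
      using theta11_norm_le_translate [OF \<tau> Im, of a] by (simp add: z'_def)
    finally have le: "norm (1 - exp (- (2 * of_real pi * \<i> * z'))) \<le> 1 / c * norm (theta11 z \<tau>)"
      using c(1) by (simp add: field_simps)
    with small obtain b :: int where
      "norm (z' - of_int b) \<le> norm (1 - exp (- (2 * of_real pi * \<i> * z')))"
      using close_to_integer_if_exp_close_to_1 [of z'] by fastforce
    with le have "norm (z - (of_int a * \<tau> + of_int b)) \<le> 1 / c * norm (theta11 z \<tau>)"
      by (simp add: z'_def diff_diff_eq)
    then show "\<exists>a b :: int. norm (z - (of_int a * \<tau> + of_int b)) \<le> 1 / c * norm (theta11 z \<tau>)"
      by blast
  qed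
qed

text \<open>The imaginary part \<open>a * Im \<tau>\<close> forces \<open>a = 0\<close>; then
  \<open>b\<close> is an integer of modulus below 1.\<close>

lemma lattice_vector_eq_0_if_small:
  assumes "norm (of_int a * \<tau> + of_int b :: complex) < min 1 (Im \<tau>)"
  shows "of_int a * \<tau> + of_int b = 0"
proof -
  have "\<bar>of_int a * Im \<tau>\<bar> < Im \<tau>"
    using abs_Im_le_cmod [of "of_int a * \<tau> + of_int b"] assms by simp
  moreover from this have "Im \<tau> > 0"
    using abs_ge_zero le_less_trans by blast
  ultimately have "\<bar>of_int a\<bar> * Im \<tau> < 1 * Im \<tau>" "Im \<tau> > 0"
    by (auto simp: abs_mult)
  then have "\<bar>of_int a :: real\<bar> < 1"
    by (metis mult_less_cancel_right_pos)
  then have "a = 0" by linarith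
  moreover have "\<bar>of_int b :: real\<bar> < 1"
    using assms \<open>a = 0\<close> by simp
  then have "b = 0" by linarith
  ultimately show ?thesis by simp
qed

subsection \<open>Factorial multiples near a lattice\<close>

text \<open>The weight \<open>Suc n\<close> in the decay of \<open>\<delta>\<close> pays for the
  multiplication of the displacement by \<open>n + 1\<close>.\<close>

lemma in_rational_span_if_fact_multiples_near_lattice:
  fixes \<tau> z :: complex and \<delta> :: "nat \<Rightarrow> real"
  assumes \<tau>: "Im \<tau> > 0"
    and near: "\<forall>\<^sub>F n in sequentially. \<exists>a b :: int. norm (fact n * z - (of_int a * \<tau> + of_int b)) \<le> \<delta> n"
    and \<delta>: "(\<lambda>n. real (Suc n) * \<delta> n) \<longlonglongrightarrow> 0"
  shows "z \<in> rational_span \<tau>"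
proof -
  \<comment> \<open>No nonzero lattice vector is shorter than \<open>\<mu>\<close>.\<close>
  define \<mu> where "\<mu> = min 1 (Im \<tau>)"
  have "\<mu> > 0" using \<tau> by (simp add: \<mu>_def)
  \<comment> \<open>Half of \<open>\<mu>\<close>, because two displacements, at \<open>n\<close> and
    at \<open>n + 1\<close>, are added below.\<close>
  have "\<forall>\<^sub>F n in sequentially. real (Suc n) * \<delta> n < \<mu> / 2"
    using \<delta> \<open>\<mu> > 0\<close> by (intro order_tendstoD(2)) auto
  from eventually_conj [OF this near] obtain N where
    N: "\<And>n. n \<ge> N \<Longrightarrow> real (Suc n) * \<delta> n < \<mu> / 2"
    "\<And>n. n \<ge> N \<Longrightarrow> \<exists>a b :: int. norm (fact n * z - (of_int a * \<tau> + of_int b)) \<le> \<delta> n"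
    unfolding eventually_sequentially by blast
  then obtain A B :: "nat \<Rightarrow> int" where AB:
    "\<And>n. n \<ge> N \<Longrightarrow> norm (fact n * z - (of_int (A n) * \<tau> + of_int (B n))) \<le> \<delta> n"
    by metis
  define \<epsilon> where "\<epsilon> = (\<lambda>n. fact n * z - (of_int (A n) * \<tau> + of_int (B n)))"
  have \<epsilon>: "norm (\<epsilon> n) \<le> \<delta> n" if "n \<ge> N" for n
    using AB [OF that] by (simp add: \<epsilon>_def)
  have \<delta>_le: "\<delta> n \<le> real (Suc n) * \<delta> n" if "n \<ge> N" for n
    using order_trans [OF norm_ge_zero \<epsilon> [OF that]] by (simp add: algebra_simps)
  have step: "\<epsilon> (Suc n) = of_nat (Suc n) * \<epsilon> n" if n: "n \<ge> N" for n
  proof -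
    define a b where "a = int (Suc n) * A n - A (Suc n)" and "b = int (Suc n) * B n - B (Suc n)"
    \<comment> \<open>The multiples of \<open>z\<close> cancel because
      \<open>fact (Suc n) = Suc n * fact n\<close>, leaving a lattice vector.\<close>
    have eq: "\<epsilon> (Suc n) - of_nat (Suc n) * \<epsilon> n = of_int a * \<tau> + of_int b"
      by (simp add: \<epsilon>_def a_def b_def algebra_simps)
    have "norm (\<epsilon> (Suc n) - of_nat (Suc n) * \<epsilon> n) \<le> norm (\<epsilon> (Suc n)) + real (Suc n) * norm (\<epsilon> n)"
      by (metis norm_triangle_ineq4 norm_mult norm_of_nat)
    also have "\<dots> \<le> \<delta> (Suc n) + real (Suc n) * \<delta> n"
      using n by (intro add_mono mult_left_mono \<epsilon>) auto
    also have "\<dots> < \<mu>"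
      using N(1) [of n] N(1) [of "Suc n"] \<delta>_le [of "Suc n"] n by linarith
    finally show ?thesis
      using lattice_vector_eq_0_if_small [of a \<tau> b] eq by (simp add: \<mu>_def)
  qed
  \<comment> \<open>From \<open>N\<close> on the norms do not decrease, while their bound tends to
    0; hence \<open>\<epsilon> N = 0\<close>.\<close>
  have mono: "norm (\<epsilon> N) \<le> norm (\<epsilon> n)" if "n \<ge> N" for n
    using that
  proof (induction n rule: dec_induct)
    case (step n)
    have "1 * norm (\<epsilon> n) \<le> real (Suc n) * norm (\<epsilon> n)"
      by (intro mult_right_mono) auto
    also have "\<dots> = norm (\<epsilon> (Suc n))"
      unfolding \<open>\<And>n. n \<ge> N \<Longrightarrow> \<epsilon> (Suc n) = _\<close> [OF step(1)] by (simp only: norm_mult norm_of_nat)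
    finally show ?case using step by simp
  qed simp
  have "norm (\<epsilon> N) \<le> real (Suc n) * \<delta> n" if "n \<ge> N" for n
    using mono [OF that] \<epsilon> [OF that] \<delta>_le [OF that] by linarith
  then have "norm (\<epsilon> N) \<le> 0"
    by (intro LIMSEQ_le_const [OF \<delta>]) blast
  then have "z = of_int (A N) / fact N * \<tau> + of_int (B N) / fact N"
    by (simp add: \<epsilon>_def field_simps)
  moreover have "of_rat (fact N) = (fact N :: complex)"
    by (metis of_nat_fact of_rat_of_nat_eq)
  ultimately have "z = of_rat (of_int (A N) / fact N) * \<tau> + of_rat (of_int (B N) / fact N)"
    by (simp add: of_rat_divide)
  then show ?thesis
    unfolding rational_span_def by blast
qed

section \<open>Divergence of the series\<close>

theorem proposition11:
  fixes \<tau>\<^sub>0 z\<^sub>0 :: complex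
  assumes "Im \<tau>\<^sub>0 > 0"
    and "z\<^sub>0 \<notin> rational_span \<tau>\<^sub>0"
  shows "fps_conv_radius (restrict_at (F_series \<tau>\<^sub>0) z\<^sub>0) = 0"
  unfolding fps_conv_radius_def
proof (rule conv_radius_zeroI, rule notI)
  fix w :: complex
  assume "w \<noteq> 0"
    and "summable (\<lambda>n. fps_nth (restrict_at (F_series \<tau>\<^sub>0) z\<^sub>0) n * w ^ n)"
  then have "(\<lambda>n. f_coeff \<tau>\<^sub>0 n z\<^sub>0 * w ^ n) \<longlonglongrightarrow> 0"
    by (intro summable_LIMSEQ_zero) (simp add: restrict_at_def F_series_def)
  then have terms_le_1: "\<forall>\<^sub>F n in sequentially. norm (f_coeff \<tau>\<^sub>0 n z\<^sub>0 * w ^ n) < 1"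
    using order_tendstoD(2) [OF tendsto_norm, of _ 0 sequentially 1] by simp
  define \<theta> where "\<theta> = (\<lambda>n. norm (theta11 (fact n * z\<^sub>0) \<tau>\<^sub>0))"
  \<comment> \<open>Once \<open>n * norm w\<close> is at least 2, the factor
    \<open>n ^ n * w ^ n\<close> has norm at least \<open>2 ^ n\<close>, so a term of norm below 1
    forces a theta value below \<open>(1/2) ^ n\<close>.\<close>
  have "\<forall>\<^sub>F n in sequentially. real n * norm w \<ge> 2"
    using \<open>w \<noteq> 0\<close> by real_asymp
  \<comment> \<open>Positivity of \<open>n\<close> excludes the coefficient at 0, which is set to
    0.\<close>
  with terms_le_1 eventually_gt_at_top [of 0]
  have \<theta>_le: "\<forall>\<^sub>F n in sequentially. \<theta> n \<le> (1/2) ^ n"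
  proof eventually_elim
    case (elim n)
    have "2 ^ n * \<theta> n \<le> (real n * norm w) ^ n * \<theta> n"
      using elim by (intro mult_right_mono power_mono) (auto simp: \<theta>_def)
    also have "\<dots> = norm (f_coeff \<tau>\<^sub>0 n z\<^sub>0 * w ^ n)"
      using elim by (simp add: f_coeff_def \<theta>_def norm_mult norm_power power_mult_distrib)
    finally show ?case
      using elim by (simp add: field_simps)
  qed
  obtain K where K: "K > 0"
    "\<And>z. K * norm (theta11 z \<tau>\<^sub>0) < 1/2 \<Longrightarrow>
      \<exists>a b :: int. norm (z - (of_int a * \<tau>\<^sub>0 + of_int b)) \<le> K * norm (theta11 z \<tau>\<^sub>0)"
    using close_to_lattice_if_theta11_small [OF assms(1)] by blast
  have "z\<^sub>0 \<in> rational_span \<tau>\<^sub>0"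
  \<comment> \<open>Applied with \<open>\<delta> n = K * (1/2) ^ n\<close>, whose decay survives the
    weight \<open>Suc n\<close>.\<close>
  proof (rule in_rational_span_if_fact_multiples_near_lattice [OF assms(1)])
    show "(\<lambda>n. real (Suc n) * (K * (1/2) ^ n)) \<longlonglongrightarrow> 0"
      by real_asymp
    \<comment> \<open>Brings \<open>K * \<theta> n\<close> below the threshold 1/2 at which the
      distance estimate applies.\<close>
    have "(\<lambda>n. K * (1/2) ^ n) \<longlonglongrightarrow> 0"
      by real_asymp
    then have "\<forall>\<^sub>F n in sequentially. K * (1/2) ^ n < 1/2"
      by (intro order_tendstoD(2)) auto
    with \<theta>_le show "\<forall>\<^sub>F n in sequentially. \<exists>a b :: int.
        norm (fact n * z\<^sub>0 - (of_int a * \<tau>\<^sub>0 + of_int b)) \<le> K * (1/2) ^ n"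
    proof eventually_elim
      case (elim n)
      have "K * \<theta> n \<le> K * (1/2) ^ n"
        using elim K(1) by simp
      with elim K(2) [of "fact n * z\<^sub>0"] show ?case
        unfolding \<theta>_def by (meson order_trans le_less_trans)
    qed
  qed
  with assms(2) show False by contradiction
qed

end
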